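(* Let $n\ge1$ and let $(P,Q)$ be a discrete imprecise copula on $L_n^2$ such that the matrices $A(P)$ and $A(Q)$ corresponding to $P$ and $Q$ are both dense alternating sign matrices. Then $(P,Q)$ is coherent. In particular, $(P,Q)$ avoids sure loss.
   Context: Let $L_n=\{0,1,\dots,n\}$. All functions below are functions $L_n^2\to[0,n]$, and inequalities between functions are pointwise. Boundary condition (B): $F(r,0)=F(0,s)=0$, $F(r,n)=r$, $F(n,s)=s$ for all $r,s\in L_n$. A discrete copula on $L_n^2$ is a function $C:L_n^2\to[0,n]$ satisfying (B) and $C(x_1,y_1)+C(x_2,y_2)\ge C(x_1,y_2)+C(x_2,y_1)$ for all $x_1\le x_2$, $y_1\le y_2$ in $L_n$. A discrete quasi-copula on $L_n^2$ is a function $Q:L_n^2\to[0,n]$ satisfying (B) and the same inequality whenever at least one of $x_1,x_2,y_1,y_2$ equals $0$ or $n$. A pair $(P,Q)$ of functions $L_n^2\to[0,n]$ is a discrete imprecise copula if both $P$ and $Q$ satisfy (B) and for all $0\le i\le j\le n$, $0\le k\le l\le n$: $Q(i,k)+P(j,l)-P(i,l)-P(j,k)\ge 0$, $P(i,k)+Q(j,l)-P(i,l)-P(j,k)\ge 0$, $Q(i,k)+Q(j,l)-Q(i,l)-P(j,k)\ge 0$, $Q(i,k)+Q(j,l)-P(i,l)-Q(j,k)\ge 0$. (It is known that then $P$ and $Q$ are discrete quasi-copulas with $P\le Q$.) To a discrete quasi-copula $Q$ on $L_n^2$ corresponds the $n\times n$ matrix $A(Q)=(a_{st})_{s,t=1}^n$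 with $a_{st}=Q(s,t)+Q(s-1,t-1)-Q(s,t-1)-Q(s-1,t)$; equivalently $Q(r,s)=\sum_{i=1}^r\sum_{j=1}^s a_{ij}$. An alternating sign matrix (ASM) is a square matrix with entries in $\{-1,0,1\}$ such that the nonzero entries in each row and each column alternate in sign and each row and each column sums to $1$. An ASM is dense if in each row and in each column there is no zero entry between two nonzero entries. For a discrete imprecise copula $(P,Q)$ let $\mathcal C(P,Q)$ be the set of all discrete copulas $C$ on $L_n^2$ with $P\le C\le Q$. The pair $(P,Q)$ avoids sure loss if $\mathcal C(P,Q)\ne\emptyset$. It is coherent if it avoids sure loss and $P(r,s)=\inf_{C\in\mathcal C(P,Q)}C(r,s)$ and $Q(r,s)=\sup_{C\in\mathcal C(P,Q)}C(r,s)$ for all $r,s\in L_n$. *)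

theory Defs
  imports "HOL-Analysis.Analysis"
begin

text \<open>
  A function on the grid \<open>{0,\<dots>,n}\<times>{0,\<dots>,n}\<close> is a total function of type \<open>nat \<Rightarrow> nat \<Rightarrow> real\<close>;
  only its values at arguments \<open>\<le> n\<close> are ever constrained or used.
\<close>

definition grid_function :: "nat \<Rightarrow> (nat \<Rightarrow> nat \<Rightarrow> real) \<Rightarrow> bool" where
  "grid_function n F \<longleftrightarrow> (\<forall>r\<le>n. \<forall>s\<le>n. 0 \<le> F r s \<and> F r s \<le> real n)"

definition grid_le :: "nat \<Rightarrow> (nat \<Rightarrow> nat \<Rightarrow> real) \<Rightarrow> (nat \<Rightarrow> nat \<Rightarrow> real) \<Rightarrow> bool" where
  "grid_le n F G \<longleftrightarrow> (\<forall>r\<le>n. \<forall>s\<le>n. F r s \<le> G r s)"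

definition boundary_condition :: "nat \<Rightarrow> (nat \<Rightarrow> nat \<Rightarrow> real) \<Rightarrow> bool" where
  "boundary_condition n F \<longleftrightarrow>
     (\<forall>r\<le>n. F r 0 = 0 \<and> F r n = real r) \<and> (\<forall>s\<le>n. F 0 s = 0 \<and> F n s = real s)"

definition discrete_copula :: "nat \<Rightarrow> (nat \<Rightarrow> nat \<Rightarrow> real) \<Rightarrow> bool" where
  "discrete_copula n C \<longleftrightarrow>
     grid_function n C \<and> boundary_condition n C \<and>
     (\<forall>x1 x2 y1 y2. x1 \<le> x2 \<and> x2 \<le> n \<and> y1 \<le> y2 \<and> y2 \<le> n \<longrightarrow>
        C x1 y1 + C x2 y2 \<ge> C x1 y2 + C x2 y1)"

definition discrete_imprecise_copula ::
  "nat \<Rightarrow> (nat \<Rightarrow> nat \<Rightarrow> real) \<Rightarrow> (nat \<Rightarrow> nat \<Rightarrow> real) \<Rightarrow> bool" where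
  "discrete_imprecise_copula n P Q \<longleftrightarrow>
     grid_function n P \<and> grid_function n Q \<and>
     boundary_condition n P \<and> boundary_condition n Q \<and>
     (\<forall>i j k l. i \<le> j \<and> j \<le> n \<and> k \<le> l \<and> l \<le> n \<longrightarrow>
        Q i k + P j l - P i l - P j k \<ge> 0 \<and>
        P i k + Q j l - P i l - P j k \<ge> 0 \<and>
        Q i k + Q j l - Q i l - P j k \<ge> 0 \<and>
        Q i k + Q j l - P i l - Q j k \<ge> 0)"

text \<open>
  An \<open>n \<times> n\<close> matrix is a function \<open>nat \<Rightarrow> nat \<Rightarrow> real\<close> whose relevant indices are \<open>1,\<dots>,n\<close>.
  For such indices the truncated subtraction below is the ordinary one.
\<close>

definition corresponding_matrix :: "(nat \<Rightarrow> nat \<Rightarrow> real) \<Rightarrow> nat \<Rightarrow> nat \<Rightarrow> real" where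
  "corresponding_matrix Q s t = Q s t + Q (s - 1) (t - 1) - Q s (t - 1) - Q (s - 1) t"

text \<open>
  A line is a row or a column. Signs of its nonzero entries alternate when any two nonzero
  entries with only zeros between them have opposite signs.
\<close>

definition alternating_line :: "nat \<Rightarrow> (nat \<Rightarrow> real) \<Rightarrow> bool" where
  "alternating_line n v \<longleftrightarrow>
     (\<forall>j\<in>{1..n}. \<forall>l\<in>{1..n}.
        j < l \<and> v j \<noteq> 0 \<and> v l \<noteq> 0 \<and> (\<forall>k. j < k \<and> k < l \<longrightarrow> v k = 0) \<longrightarrow> sgn (v l) = - sgn (v j))"

definition dense_line :: "nat \<Rightarrow> (nat \<Rightarrow> real) \<Rightarrow> bool" where
  "dense_line n v \<longleftrightarrow>
     \<not> (\<exists>j k l. 1 \<le> j \<and> j < k \<and> k < l \<and> l \<le> n \<and> v j \<noteq> 0 \<and> v k = 0 \<and> v l \<noteq> 0)"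

definition alternating_sign_matrix :: "nat \<Rightarrow> (nat \<Rightarrow> nat \<Rightarrow> real) \<Rightarrow> bool" where
  "alternating_sign_matrix n A \<longleftrightarrow>
     (\<forall>i\<in>{1..n}. \<forall>j\<in>{1..n}. A i j \<in> {-1, 0, 1}) \<and>
     (\<forall>i\<in>{1..n}. alternating_line n (\<lambda>j. A i j) \<and> (\<Sum>j=1..n. A i j) = 1) \<and>
     (\<forall>j\<in>{1..n}. alternating_line n (\<lambda>i. A i j) \<and> (\<Sum>i=1..n. A i j) = 1)"

definition dense_ASM :: "nat \<Rightarrow> (nat \<Rightarrow> nat \<Rightarrow> real) \<Rightarrow> bool" where
  "dense_ASM n A \<longleftrightarrow>
     alternating_sign_matrix n A \<and>
     (\<forall>i\<in>{1..n}. dense_line n (\<lambda>j. A i j)) \<and>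
     (\<forall>j\<in>{1..n}. dense_line n (\<lambda>i. A i j))"

definition copulas_between ::
  "nat \<Rightarrow> (nat \<Rightarrow> nat \<Rightarrow> real) \<Rightarrow> (nat \<Rightarrow> nat \<Rightarrow> real) \<Rightarrow> (nat \<Rightarrow> nat \<Rightarrow> real) set" where
  "copulas_between n P Q = {C. discrete_copula n C \<and> grid_le n P C \<and> grid_le n C Q}"

definition avoids_sure_loss ::
  "nat \<Rightarrow> (nat \<Rightarrow> nat \<Rightarrow> real) \<Rightarrow> (nat \<Rightarrow> nat \<Rightarrow> real) \<Rightarrow> bool" where
  "avoids_sure_loss n P Q \<longleftrightarrow> copulas_between n P Q \<noteq> {}"

text \<open>
  The infima and suprema below are the genuine ones: the values \<open>C r s\<close> lie in \<open>[0,n]\<close>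
  and the index set is nonempty by the first conjunct.
\<close>

definition coherent ::
  "nat \<Rightarrow> (nat \<Rightarrow> nat \<Rightarrow> real) \<Rightarrow> (nat \<Rightarrow> nat \<Rightarrow> real) \<Rightarrow> bool" where
  "coherent n P Q \<longleftrightarrow>
     avoids_sure_loss n P Q \<and>
     (\<forall>r\<le>n. \<forall>s\<le>n.
        P r s = (INF C\<in>copulas_between n P Q. C r s) \<and>
        Q r s = (SUP C\<in>copulas_between n P Q. C r s))"

end

theory Submission
  imports Defs
begin

text \<open>
  The idea is to repair the negative entries of the matrices locally. In a dense alternating sign
  matrix every \<open>-1\<close> sits in the interior, and its four neighbours are all \<open>1\<close>. Let \<open>A\<close> be the matrix of the upper bound \<open>Q\<close>.
  Lowering the value of \<open>Q\<close> by \<open>1\<close> at a single grid point adds \<open>1\<close> to the two adjacent matrix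
  entries on one diagonal and subtracts \<open>1\<close> from the two on the other. So a \<open>-1\<close> at the cell
  \<open>(s,t)\<close> is repaired by lowering \<open>Q\<close> at one of the two grid points \<open>(s,t-1)\<close> and \<open>(s-1,t)\<close>. At
  these two points there is room: the last two inequalities in the definition of an imprecise
  copula, applied to the unit square of that cell, say exactly that \<open>P \<le> Q - 1\<close> there.

  It remains to choose one point for every \<open>-1\<close> without spoiling other cells. The two candidates
  for a given \<open>-1\<close> lie in consecutive rows, so a choice by the parity of the row selects exactly
  one. A point so lowered takes \<open>1\<close> only from cells that are neighbours of a \<open>-1\<close>, whose entry is
  therefore \<open>1\<close>; and the two points that can take from such a cell again lie in consecutive rows,
  so only one of them does. The result is a copula between \<open>P\<close> and \<open>Q\<close> that agrees with \<open>Q\<close> on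
  all rows of the other parity (lemma \<open>copula_touching_upper_bound\<close>). Since either parity may be
  chosen, \<open>Q\<close> is the pointwise maximum of the copulas in between.

  The lower bound follows by symmetry: the reflection \<open>F \<mapsto> (\<lambda>r c. r - F r (n - c))\<close> maps
  copulas to copulas, reverses the order and reflects the matrices, so that it turns a lower bound
  into an upper one.
\<close>

section \<open>The neighbours of a negative entry\<close>

text \<open>
  After a \<open>-1\<close>, a partial sum of an alternating line is at most \<open>0\<close>, and after a \<open>1\<close> it is at
  most \<open>1\<close>; the bound below is linear in \<open>v j\<close> to cover both cases. Density makes the induction
  immediate: if the preceding entry vanishes, so do all earlier ones.
\<close>

lemma dense_alternating_prefix_sum_le:
  assumes alt: "alternating_line n v" and dense: "dense_line n v"
    and entries: "\<forall>j\<in>{1..n}. v j \<in> {-1, 0, 1}"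
    and j: "1 \<le> j" "j \<le> n" "v j \<noteq> 0"
  shows "2 * (\<Sum>k=1..j. v k) \<le> 1 + v j"
  using j
proof (induction j)
  case 0
  then show ?case by simp
next
  case (Suc j)
  have vS: "v (Suc j) \<in> {-1, 1}"
    using entries Suc.prems by auto
  show ?case
  proof (cases "j = 0 \<or> v j = 0")
    case True
    have "v k = 0" if "1 \<le> k" "k \<le> j" for k
      using dense True that Suc.prems unfolding dense_line_def
      by (metis le_neq_implies_less lessI not_one_le_zero le_trans)
    then have "(\<Sum>k=1..j. v k) = 0"
      by (intro sum.neutral) auto
    then show ?thesis
      using vS by auto
  next
    case False
    then have "sgn (v (Suc j)) = - sgn (v j)"
      using alt Suc.prems unfolding alternating_line_def by auto
    moreover have "v j \<in> {-1, 1}"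
      using entries False Suc.prems by auto
    ultimately have "v (Suc j) = - v j"
      using vS by auto
    moreover have "2 * (\<Sum>k=1..j. v k) \<le> 1 + v j"
      using Suc.IH False Suc.prems by auto
    ultimately show ?thesis
      using \<open>v j \<in> {-1, 1}\<close> by auto
  qed
qed

text \<open>
  If no \<open>1\<close> followed, the \<open>-1\<close> would be the last nonzero entry by density, and the whole line
  would sum to at most \<open>0\<close>.
\<close>

lemma one_after_negative_entry:
  assumes alt: "alternating_line n v" and dense: "dense_line n v"
    and entries: "\<forall>j\<in>{1..n}. v j \<in> {-1, 0, 1}" and total: "(\<Sum>j=1..n. v j) = 1"
    and j: "1 \<le> j" "j \<le> n" "v j = -1"
  shows "j < n \<and> v (j + 1) = 1"
proof -
  have prefix: "(\<Sum>k=1..j. v k) \<le> 0"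
    using dense_alternating_prefix_sum_le[OF alt dense entries, of j] j by simp
  have "j < n \<and> v (j + 1) \<noteq> 0"
  proof (rule ccontr)
    assume "\<not> ?thesis"
    then have last: "j = n \<or> v (j + 1) = 0"
      using j by auto
    have "v k = 0" if "k \<in> {1..n} - {1..j}" for k
    proof (cases "k = j + 1")
      case True
      then show ?thesis using last that by auto
    next
      case False
      have "1 \<le> j \<and> j < j + 1 \<and> j + 1 < k \<and> k \<le> n \<and> v j \<noteq> 0 \<and> v (j + 1) = 0"
        using False last that j by auto
      then show ?thesis
        using dense unfolding dense_line_def by blast
    qed
    then have "(\<Sum>k=1..j. v k) = (\<Sum>k=1..n. v k)"
      using j by (intro sum.mono_neutral_left) auto
    then show False
      using prefix total by simp
  qed
  moreover from this have "sgn (v (j + 1)) = - sgn (v j)"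
    using alt[unfolded alternating_line_def, rule_format, of j "j + 1"] j by auto
  moreover have "v (j + 1) \<in> {-1, 0, 1}"
    using calculation entries j by auto
  ultimately show ?thesis
    using j by auto
qed

lemma alternating_line_rev:
  assumes "alternating_line n v"
  shows "alternating_line n (\<lambda>k. v (n + 1 - k))"
  unfolding alternating_line_def
proof (intro ballI impI, elim conjE)
  fix j l
  assume jl: "j \<in> {1..n}" "l \<in> {1..n}" "j < l" "v (n + 1 - j) \<noteq> 0" "v (n + 1 - l) \<noteq> 0"
    and gap: "\<forall>k. j < k \<and> k < l \<longrightarrow> v (n + 1 - k) = 0"
  have "v k = 0" if "n + 1 - l < k" "k < n + 1 - j" for k
  proof -
    have "j < n + 1 - k \<and> n + 1 - k < l" "n + 1 - (n + 1 - k) = k"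
      using that by auto
    then show ?thesis using gap by metis
  qed
  moreover have "n + 1 - l \<in> {1..n}" "n + 1 - j \<in> {1..n}" "n + 1 - l < n + 1 - j"
    using jl by auto
  ultimately have "sgn (v (n + 1 - j)) = - sgn (v (n + 1 - l))"
    using assms jl unfolding alternating_line_def by blast
  then show "sgn (v (n + 1 - l)) = - sgn (v (n + 1 - j))"
    by simp
qed

lemma dense_line_rev:
  assumes "dense_line n v"
  shows "dense_line n (\<lambda>k. v (n + 1 - k))"
  unfolding dense_line_def
proof (intro notI, elim exE conjE)
  fix j k l
  assume "1 \<le> j" "j < k" "k < l" "l \<le> n"
    "v (n + 1 - j) \<noteq> 0" "v (n + 1 - k) = 0" "v (n + 1 - l) \<noteq> 0"
  moreover from this have "1 \<le> n + 1 - l" "n + 1 - l < n + 1 - k" "n + 1 - k < n + 1 - j"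
    "n + 1 - j \<le> n"
    by auto
  ultimately show False
    using assms unfolding dense_line_def by blast
qed

lemma neighbours_of_negative_entry:
  assumes alt: "alternating_line n v" and dense: "dense_line n v"
    and entries: "\<forall>j\<in>{1..n}. v j \<in> {-1, 0, 1}" and total: "(\<Sum>j=1..n. v j) = 1"
    and j: "1 \<le> j" "j \<le> n" "v j = -1"
  shows "1 < j \<and> j < n \<and> v (j - 1) = 1 \<and> v (j + 1) = 1"
proof -
  have "n + 1 - j < n \<and> v (n + 1 - (n + 1 - j + 1)) = 1"
  proof (rule one_after_negative_entry[where v = "\<lambda>k. v (n + 1 - k)",
        OF alternating_line_rev[OF alt] dense_line_rev[OF dense]])
    show "\<forall>k\<in>{1..n}. v (n + 1 - k) \<in> {-1, 0, 1}"
    proof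
      fix k assume "k \<in> {1..n}"
      then have "n + 1 - k \<in> {1..n}" by auto
      then show "v (n + 1 - k) \<in> {-1, 0, 1}" using entries by blast
    qed
    show "(\<Sum>k=1..n. v (n + 1 - k)) = 1"
      using total sum.atLeastAtMost_rev[of v 1 n] by (simp add: add.commute)
    show "1 \<le> n + 1 - j" "n + 1 - j \<le> n" "v (n + 1 - (n + 1 - j)) = -1"
      using j by auto
  qed
  moreover have "n + 1 - (n + 1 - j + 1) = j - 1"
    using j by auto
  ultimately show ?thesis
    using one_after_negative_entry[OF assms] j by auto
qed

definition negatives_amid_ones :: "nat \<Rightarrow> (nat \<Rightarrow> nat \<Rightarrow> real) \<Rightarrow> bool" where
  "negatives_amid_ones n A \<longleftrightarrow>
     (\<forall>s\<in>{1..n}. \<forall>t\<in>{1..n}. A s t \<in> {-1, 0, 1} \<and>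
        (A s t = -1 \<longrightarrow> 1 < s \<and> s < n \<and> 1 < t \<and> t < n \<and>
           A (s - 1) t = 1 \<and> A (s + 1) t = 1 \<and> A s (t - 1) = 1 \<and> A s (t + 1) = 1))"

lemma dense_ASM_negatives_amid_ones:
  assumes "dense_ASM n A"
  shows "negatives_amid_ones n A"
  unfolding negatives_amid_ones_def
proof (intro ballI conjI impI)
  fix s t assume st: "s \<in> {1..n}" "t \<in> {1..n}"
  note asm = assms[unfolded dense_ASM_def alternating_sign_matrix_def]
  show "A s t \<in> {-1, 0, 1}"
    using asm st by blast
  assume neg: "A s t = -1"
  have "1 < t \<and> t < n \<and> A s (t - 1) = 1 \<and> A s (t + 1) = 1"
    by (rule neighbours_of_negative_entry) (use asm st neg in auto)
  moreover have "1 < s \<and> s < n \<and> A (s - 1) t = 1 \<and> A (s + 1) t = 1"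
    by (rule neighbours_of_negative_entry[where v = "\<lambda>i. A i t"]) (use asm st neg in auto)
  ultimately show "1 < s" "s < n" "1 < t" "t < n"
    "A (s - 1) t = 1" "A (s + 1) t = 1" "A s (t - 1) = 1" "A s (t + 1) = 1"
    by blast+
qed

section \<open>Copulas from nonnegative matrices\<close>

lemma discrete_copulaI:
  assumes bc: "boundary_condition n C"
    and cells: "\<And>s t. s \<in> {1..n} \<Longrightarrow> t \<in> {1..n} \<Longrightarrow> corresponding_matrix C s t \<ge> 0"
  shows "discrete_copula n C"
proof -
  have strip: "C (Suc x) y1 - C x y1 \<le> C (Suc x) y2 - C x y2"
    if "x < n" "y1 \<le> y2" "y2 \<le> n" for x y1 y2
    using that(2,3)
  proof (induction y2 rule: dec_induct)
    case (step y)
    then show ?case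
      using cells[of "Suc x" "Suc y"] that(1) by (auto simp: corresponding_matrix_def)
  qed simp
  have incr: "C x1 y1 + C x2 y2 \<ge> C x1 y2 + C x2 y1"
    if "x1 \<le> x2" "x2 \<le> n" "y1 \<le> y2" "y2 \<le> n" for x1 x2 y1 y2
    using that(1,2)
  proof (induction x2 rule: dec_induct)
    case (step x)
    then show ?case
      using strip[of x y1 y2] that(3,4) by auto
  qed simp
  have "0 \<le> C r s \<and> C r s \<le> real n" if "r \<le> n" "s \<le> n" for r s
    using incr[of 0 r 0 s] incr[of 0 r s n] that bc unfolding boundary_condition_def by fastforce
  then show ?thesis
    using bc incr unfolding discrete_copula_def grid_function_def by blast
qed

lemma discrete_copula_cell_nonneg:
  assumes "discrete_copula n C" "s \<in> {1..n}" "t \<in> {1..n}"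
  shows "corresponding_matrix C s t \<ge> 0"
proof -
  have "C (s - 1) (t - 1) + C s t \<ge> C (s - 1) t + C s (t - 1)"
    using assms unfolding discrete_copula_def by auto
  then show ?thesis
    by (simp add: corresponding_matrix_def)
qed

section \<open>A copula that touches the upper bound\<close>

text \<open>
  The inner grid point \<open>(r, c)\<close> is the common corner of the cells \<open>(r, c)\<close>, \<open>(r, c + 1)\<close>,
  \<open>(r + 1, c)\<close> and \<open>(r + 1, c + 1)\<close>. Lowering a function there increases the entries of the
  second and the third of these cells, and decreases those of the other two.
\<close>

definition repairs_negative :: "nat \<Rightarrow> (nat \<Rightarrow> nat \<Rightarrow> real) \<Rightarrow> nat \<Rightarrow> nat \<Rightarrow> bool" where
  "repairs_negative n A r c \<longleftrightarrow>
     1 \<le> r \<and> r < n \<and> 1 \<le> c \<and> c < n \<and> (A r (c + 1) = -1 \<or> A (r + 1) c = -1)"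

text \<open>
  For every \<open>-1\<close>, exactly one of its two repairing points lies in a row whose parity differs from
  that of \<open>r0\<close>. A cell that loses something is a neighbour of a \<open>-1\<close>, hence holds a \<open>1\<close>, and loses
  at one of two points in consecutive rows, so again at most once. The two \<open>room\<close> assumptions are
  inequalities on unit squares; at a \<open>-1\<close> they leave room for lowering \<open>Q\<close> by \<open>1\<close>.
\<close>

lemma copula_touching_upper_bound:
  fixes P Q :: "nat \<Rightarrow> nat \<Rightarrow> real"
  defines "A \<equiv> corresponding_matrix Q"
  assumes bc: "boundary_condition n Q" and le: "grid_le n P Q"
    and room_left: "\<And>s t. s \<in> {1..n} \<Longrightarrow> t \<in> {1..n} \<Longrightarrow> P s (t - 1) \<le> Q s (t - 1) + A s t"
    and room_above: "\<And>s t. s \<in> {1..n} \<Longrightarrow> t \<in> {1..n} \<Longrightarrow> P (s - 1) t \<le> Q (s - 1) t + A s t"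
    and neg: "negatives_amid_ones n A"
  shows "\<exists>C\<in>copulas_between n P Q. \<forall>c. C r0 c = Q r0 c"
proof -
  let ?S = "repairs_negative n A"
  define w :: "nat \<Rightarrow> nat \<Rightarrow> real" where "w r c = of_bool (?S r c \<and> odd (r + r0))" for r c
  define C where "C r c = Q r c - w r c" for r c
  have w01: "w r c = 0 \<or> w r c = 1" for r c
    by (auto simp: w_def)
  have bcC: "boundary_condition n C"
    using bc unfolding boundary_condition_def C_def w_def repairs_negative_def by auto
  have cell: "corresponding_matrix C s t \<ge> 0" if st: "s \<in> {1..n}" "t \<in> {1..n}" for s t
  proof -
    have expand: "corresponding_matrix C s t =
        A s t - w s t - w (s - 1) (t - 1) + w s (t - 1) + w (s - 1) t"
      by (simp add: corresponding_matrix_def C_def A_def)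
    have parity: "odd (s + r0) \<longleftrightarrow> \<not> odd (s - 1 + r0)"
      using st by (cases s) auto
    have lose: "A s t = 1" if "?S s t \<or> ?S (s - 1) (t - 1)"
      using that
    proof
      assume S: "?S s t"
      then have "s + 1 \<in> {1..n}" "t + 1 \<in> {1..n}" "A s (t + 1) = -1 \<or> A (s + 1) t = -1"
        by (auto simp: repairs_negative_def)
      then show ?thesis
        using neg st unfolding negatives_amid_ones_def by (metis add_diff_cancel_right')
    next
      assume S: "?S (s - 1) (t - 1)"
      then have "s - 1 \<in> {1..n}" "t - 1 \<in> {1..n}" "A (s - 1) t = -1 \<or> A s (t - 1) = -1"
        using st by (auto simp: repairs_negative_def)
      moreover have "s - 1 + 1 = s" "t - 1 + 1 = t"
        using st by auto
      ultimately show ?thesis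
        using neg st unfolding negatives_amid_ones_def by metis
    qed
    consider "A s t = -1" | "A s t = 0" | "A s t = 1"
      using neg st unfolding negatives_amid_ones_def by blast
    then show ?thesis
    proof cases
      case 1
      then have "1 < s" "s < n" "1 < t" "t < n"
        using neg st unfolding negatives_amid_ones_def by blast+
      then have "?S s (t - 1)" "?S (s - 1) t"
        using 1 by (auto simp: repairs_negative_def)
      then have "w s (t - 1) + w (s - 1) t = 1"
        using parity by (auto simp: w_def)
      moreover have "w s t = 0" "w (s - 1) (t - 1) = 0"
        using lose 1 by (auto simp: w_def)
      ultimately show ?thesis
        using expand 1 by simp
    next
      case 2
      then have "w s t = 0" "w (s - 1) (t - 1) = 0"
        using lose by (auto simp: w_def)
      then show ?thesis
        using expand 2 w01[of s "t - 1"] w01[of "s - 1" t] by auto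
    next
      case 3
      have "w s t + w (s - 1) (t - 1) \<le> 1"
        using parity by (auto simp: w_def)
      then show ?thesis
        using expand 3 w01[of s "t - 1"] w01[of "s - 1" t] by auto
    qed
  qed
  have "P r c \<le> C r c" if rc: "r \<le> n" "c \<le> n" for r c
  proof (cases "?S r c")
    case True
    then have "P r c \<le> Q r c - 1"
      using room_left[of r "c + 1"] room_above[of "r + 1" c] by (auto simp: repairs_negative_def)
    then show ?thesis
      using w01[of r c] by (auto simp: C_def)
  next
    case False
    then show ?thesis
      using le rc by (auto simp: C_def w_def grid_le_def)
  qed
  moreover have "C r c \<le> Q r c" for r c
    using w01[of r c] by (auto simp: C_def)
  ultimately have "C \<in> copulas_between n P Q"
    using discrete_copulaI[OF bcC cell] by (auto simp: copulas_between_def grid_le_def)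
  moreover have "C r0 c = Q r0 c" for c
    by (simp add: C_def w_def)
  ultimately show ?thesis
    by blast
qed

section \<open>Reflection\<close>

definition reflect :: "nat \<Rightarrow> (nat \<Rightarrow> nat \<Rightarrow> real) \<Rightarrow> nat \<Rightarrow> nat \<Rightarrow> real" where
  "reflect n F r c = real r - F r (n - c)"

lemma reflect_reflect: "c \<le> n \<Longrightarrow> reflect n (reflect n F) r c = F r c"
  by (simp add: reflect_def)

lemma boundary_condition_reflect:
  "boundary_condition n F \<Longrightarrow> boundary_condition n (reflect n F)"
  by (auto simp: boundary_condition_def reflect_def of_nat_diff)

lemma grid_le_reflect: "grid_le n F G \<Longrightarrow> grid_le n (reflect n G) (reflect n F)"
  by (auto simp: grid_le_def reflect_def)

lemma corresponding_matrix_reflect: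
  assumes "s \<in> {1..n}" "t \<in> {1..n}"
  shows "corresponding_matrix (reflect n F) s t = corresponding_matrix F s (n + 1 - t)"
proof -
  have "n - (t - 1) = n + 1 - t" "n + 1 - t - 1 = n - t"
    using assms by auto
  then show ?thesis
    by (simp add: corresponding_matrix_def reflect_def)
qed

lemma discrete_copula_reflect:
  assumes "discrete_copula n C"
  shows "discrete_copula n (reflect n C)"
proof (rule discrete_copulaI)
  show "boundary_condition n (reflect n C)"
    using assms boundary_condition_reflect unfolding discrete_copula_def by blast
  show "corresponding_matrix (reflect n C) s t \<ge> 0" if "s \<in> {1..n}" "t \<in> {1..n}" for s t
    unfolding corresponding_matrix_reflect[OF that]
    by (rule discrete_copula_cell_nonneg[OF assms]) (use that in auto)
qed

lemma negatives_amid_ones_reflect: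
  assumes "negatives_amid_ones n (corresponding_matrix F)"
  shows "negatives_amid_ones n (corresponding_matrix (reflect n F))"
  unfolding negatives_amid_ones_def
proof (intro ballI)
  let ?A = "corresponding_matrix F" and ?B = "corresponding_matrix (reflect n F)"
  fix s t assume st: "s \<in> {1..n}" "t \<in> {1..n}"
  define u where "u = n + 1 - t"
  have u: "u \<in> {1..n}" "?B s t = ?A s u"
    using st by (auto simp: u_def corresponding_matrix_reflect)
  have A: "?A s u \<in> {-1, 0, 1}" "?A s u = -1 \<longrightarrow> 1 < s \<and> s < n \<and> 1 < u \<and> u < n \<and>
      ?A (s - 1) u = 1 \<and> ?A (s + 1) u = 1 \<and> ?A s (u - 1) = 1 \<and> ?A s (u + 1) = 1"
    using assms st u unfolding negatives_amid_ones_def by blast+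
  have "1 < s \<and> s < n \<and> 1 < t \<and> t < n \<and>
      ?B (s - 1) t = 1 \<and> ?B (s + 1) t = 1 \<and> ?B s (t - 1) = 1 \<and> ?B s (t + 1) = 1"
    if "?A s u = -1"
  proof -
    have *: "1 < s" "s < n" "1 < u" "u < n"
      "?A (s - 1) u = 1" "?A (s + 1) u = 1" "?A s (u - 1) = 1" "?A s (u + 1) = 1"
      using A that by blast+
    have t: "1 < t" "t < n"
      using *(3,4) unfolding u_def by auto
    moreover have "n + 1 - (t - 1) = u + 1" "n + 1 - (t + 1) = u - 1"
      using t by (auto simp: u_def)
    moreover have "s - 1 \<in> {1..n}" "s + 1 \<in> {1..n}" "t - 1 \<in> {1..n}" "t + 1 \<in> {1..n}"
      using *(1,2) t by auto
    ultimately show ?thesis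
      using * st by (simp only: corresponding_matrix_reflect u_def[symmetric] simp_thms)
  qed
  then show "?B s t \<in> {-1, 0, 1} \<and> (?B s t = -1 \<longrightarrow> 1 < s \<and> s < n \<and> 1 < t \<and> t < n \<and>
      ?B (s - 1) t = 1 \<and> ?B (s + 1) t = 1 \<and> ?B s (t - 1) = 1 \<and> ?B s (t + 1) = 1)"
    using A(1) u(2) by simp
qed

text \<open>
  Reflected columns turn the antidiagonal corners of a cell into the diagonal ones, so here the
  room is assumed at \<open>(s, t)\<close> and \<open>(s - 1, t - 1)\<close>.
\<close>

lemma copula_touching_lower_bound:
  fixes P Q :: "nat \<Rightarrow> nat \<Rightarrow> real"
  defines "A \<equiv> corresponding_matrix P"
  assumes bc: "boundary_condition n P" and le: "grid_le n P Q"
    and room_here: "\<And>s t. s \<in> {1..n} \<Longrightarrow> t \<in> {1..n} \<Longrightarrow> P s t \<le> Q s t + A s t"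
    and room_diag: "\<And>s t. s \<in> {1..n} \<Longrightarrow> t \<in> {1..n} \<Longrightarrow>
      P (s - 1) (t - 1) \<le> Q (s - 1) (t - 1) + A s t"
    and neg: "negatives_amid_ones n A"
  shows "\<exists>C\<in>copulas_between n P Q. \<forall>c\<le>n. C r0 c = P r0 c"
proof -
  let ?P = "reflect n Q" and ?Q = "reflect n P"
  have room: "?P s (t - 1) \<le> ?Q s (t - 1) + corresponding_matrix ?Q s t"
    "?P (s - 1) t \<le> ?Q (s - 1) t + corresponding_matrix ?Q s t"
    if st: "s \<in> {1..n}" "t \<in> {1..n}" for s t
  proof -
    have idx: "n - (t - 1) = n + 1 - t" "n - t = n + 1 - t - 1" "n + 1 - t \<in> {1..n}"
      using st by auto
    show "?P s (t - 1) \<le> ?Q s (t - 1) + corresponding_matrix ?Q s t"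
      unfolding corresponding_matrix_reflect[OF st] reflect_def idx(1)
      using room_here[OF st(1) idx(3)] by (simp add: A_def)
    show "?P (s - 1) t \<le> ?Q (s - 1) t + corresponding_matrix ?Q s t"
      unfolding corresponding_matrix_reflect[OF st] reflect_def idx(2)
      using room_diag[OF st(1) idx(3)] by (simp add: A_def)
  qed
  obtain D where D: "D \<in> copulas_between n ?P ?Q" "\<forall>c. D r0 c = ?Q r0 c"
    using copula_touching_upper_bound[OF boundary_condition_reflect[OF bc] grid_le_reflect[OF le]
        room negatives_amid_ones_reflect[OF neg[unfolded A_def]]] by blast
  have "discrete_copula n (reflect n D)"
    using D(1) discrete_copula_reflect by (auto simp: copulas_between_def)
  moreover have "grid_le n (reflect n ?Q) (reflect n D)" "grid_le n (reflect n D) (reflect n ?P)"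
    using D(1) grid_le_reflect by (auto simp: copulas_between_def)
  ultimately have "reflect n D \<in> copulas_between n P Q"
    by (simp add: copulas_between_def grid_le_def reflect_reflect)
  moreover have "reflect n D r0 c = P r0 c" if "c \<le> n" for c
    using D(2) that by (simp add: reflect_def)
  ultimately show ?thesis
    by blast
qed

section \<open>Coherence\<close>

theorem theorem5p1:
  fixes n :: nat and P Q :: "nat \<Rightarrow> nat \<Rightarrow> real"
  assumes "n \<ge> 1"
    and "discrete_imprecise_copula n P Q"
    and "dense_ASM n (corresponding_matrix P)"
    and "dense_ASM n (corresponding_matrix Q)"
  shows "coherent n P Q \<and> avoids_sure_loss n P Q"
proof -
  let ?K = "copulas_between n P Q"
  have bc: "boundary_condition n P" "boundary_condition n Q"
    and ineqs: "\<And>i j k l. i \<le> j \<Longrightarrow> j \<le> n \<Longrightarrow> k \<le> l \<Longrightarrow> l \<le> n \<Longrightarrow>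
        Q i k + P j l - P i l - P j k \<ge> 0 \<and>
        P i k + Q j l - P i l - P j k \<ge> 0 \<and>
        Q i k + Q j l - Q i l - P j k \<ge> 0 \<and>
        Q i k + Q j l - P i l - Q j k \<ge> 0"
    using assms(2) unfolding discrete_imprecise_copula_def by blast+
  \<comment> \<open>A degenerate rectangle gives the order of the bounds, a unit square the room at each corner.\<close>
  have le: "grid_le n P Q"
    unfolding grid_le_def
  proof (intro allI impI)
    fix r s assume "r \<le> n" "s \<le> n"
    then show "P r s \<le> Q r s"
      using ineqs[of r r s s] by auto
  qed
  have unit: "P s t \<le> Q s t + corresponding_matrix P s t \<and>
      P (s - 1) (t - 1) \<le> Q (s - 1) (t - 1) + corresponding_matrix P s t \<and>
      P s (t - 1) \<le> Q s (t - 1) + corresponding_matrix Q s t \<and>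
      P (s - 1) t \<le> Q (s - 1) t + corresponding_matrix Q s t"
    if "s \<in> {1..n}" "t \<in> {1..n}" for s t
    using ineqs[of "s - 1" s "t - 1" t] that by (auto simp: corresponding_matrix_def)
  have upper: "\<exists>C\<in>?K. \<forall>c. C r c = Q r c" for r
    by (rule copula_touching_upper_bound[OF bc(2) le])
      (use unit dense_ASM_negatives_amid_ones[OF assms(4)] in auto)
  have lower: "\<exists>C\<in>?K. \<forall>c\<le>n. C r c = P r c" for r
    by (rule copula_touching_lower_bound[OF bc(1) le])
      (use unit dense_ASM_negatives_amid_ones[OF assms(3)] in auto)
  have between: "P r s \<le> C r s" "C r s \<le> Q r s" if "C \<in> ?K" "r \<le> n" "s \<le> n" for C r s
    using that by (auto simp: copulas_between_def grid_le_def)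
  have "avoids_sure_loss n P Q"
    using upper unfolding avoids_sure_loss_def by blast
  moreover have "P r s = (INF C\<in>?K. C r s)" if rs: "r \<le> n" "s \<le> n" for r s
  proof (rule cInf_eq_minimum[symmetric])
    show "P r s \<in> (\<lambda>C. C r s) ` ?K"
      using lower[of r] rs by (metis imageI)
  qed (use between rs in auto)
  moreover have "Q r s = (SUP C\<in>?K. C r s)" if rs: "r \<le> n" "s \<le> n" for r s
  proof (rule cSup_eq_maximum[symmetric])
    show "Q r s \<in> (\<lambda>C. C r s) ` ?K"
      using upper[of r] by (metis imageI)
  qed (use between rs in auto)
  ultimately show ?thesis
    unfolding coherent_def by blast
qed

end
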